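(* Let $\Phi_1(r)=\dfrac{r}{\sqrt{r^2+4}}$. For every $m\in\mathbb{Z}$, every solution $(u,v)^T$ of the homogeneous problem $\mathcal{L}_{1,m}\binom uv=0$ on $(0,\infty)$ which is bounded on $(0,\infty)$ (real-valued $u,v$; i.e. defined on all of $\mathbb{R}^2$ and bounded as functions of $r=|z|$) belongs to $$\mathrm{Span}_{\mathbb{R}}\left\{\binom{0}{\Phi_1},\ \binom{\Phi_1'}{-\frac1r\Phi_1},\ \binom{\Phi_1'}{\frac1r\Phi_1}\right\}.$$
   Context: For $m\in\mathbb{Z}$ the operator $\mathcal{L}_{1,m}$ acts on pairs of real-valued functions $(u,v)^T$ of $r\in(0,\infty)$ by $$\mathcal{L}_{1,m}\binom uv=\binom{-u''-\frac1ru'+\mathfrak{B}u'+\frac{m^2}{r^2}u+(\mathfrak{C}+\mathfrak{D})u+m\mathfrak{A}v}{-v''-\frac1rv'+\mathfrak{B}v'+\frac{m^2}{r^2}v+(\mathfrak{C}-\mathfrak{D})v+m\mathfrak{A}u},$$ where, with $n=1$ and $\Phi=\Phi_1$, $$\mathfrak{A}=\frac{4n}{r^2}\frac1{2-\Phi^2},\qquad \mathfrak{B}=-\frac{2\Phi\Phi'}{2-\Phi^2},$$ $$\mathfrak{C}=\frac{n^2}{r^2}\frac4{(2-\Phi^2)^2}-\frac{(\Phi')^2\Phi^2}{(2-\Phi^2)^2}-\frac32\Phi^4+3\Phi^2-1,$$ $$\mathfrak{D}=\frac{n^2}{r^2}\frac{2\Phi^2}{(2-\Phi^2)^2}-\frac{2(\Phi')^2}{(2-\Phi^2)^2}-\Phi^4+\frac32\Phi^2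 .$$ (This is the Fourier-mode-$m$ part of the linearization of the complex sine-Gordon II equation at its degree-1 vortex $\Phi_1(r)e^{i\theta}$.) *)

theory Defs
  imports "HOL-Analysis.Analysis"
begin

text \<open>
  Coefficients of the linearization of the complex sine-Gordon II equation at a degree-\<open>n\<close>
  vortex with radial profile \<open>\<Phi>\<close>, as functions of \<open>r > 0\<close>.  The values at \<open>r \<le> 0\<close> have no meaning.
\<close>

definition coeff_A :: "nat \<Rightarrow> (real \<Rightarrow> real) \<Rightarrow> real \<Rightarrow> real" where
  "coeff_A n \<Phi> r = 4 * real n / r\<^sup>2 * (1 / (2 - (\<Phi> r)\<^sup>2))"

definition coeff_B :: "(real \<Rightarrow> real) \<Rightarrow> real \<Rightarrow> real" where
  "coeff_B \<Phi> r = - (2 * \<Phi> r * deriv \<Phi> r / (2 - (\<Phi> r)\<^sup>2))"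

definition coeff_C :: "nat \<Rightarrow> (real \<Rightarrow> real) \<Rightarrow> real \<Rightarrow> real" where
  "coeff_C n \<Phi> r =
     (real n)\<^sup>2 / r\<^sup>2 * (4 / (2 - (\<Phi> r)\<^sup>2)\<^sup>2)
     - (deriv \<Phi> r)\<^sup>2 * (\<Phi> r)\<^sup>2 / (2 - (\<Phi> r)\<^sup>2)\<^sup>2
     - 3 / 2 * \<Phi> r ^ 4 + 3 * (\<Phi> r)\<^sup>2 - 1"

definition coeff_D :: "nat \<Rightarrow> (real \<Rightarrow> real) \<Rightarrow> real \<Rightarrow> real" where
  "coeff_D n \<Phi> r =
     (real n)\<^sup>2 / r\<^sup>2 * (2 * (\<Phi> r)\<^sup>2 / (2 - (\<Phi> r)\<^sup>2)\<^sup>2)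
     - 2 * (deriv \<Phi> r)\<^sup>2 / (2 - (\<Phi> r)\<^sup>2)\<^sup>2
     - \<Phi> r ^ 4 + 3 / 2 * (\<Phi> r)\<^sup>2"

definition linop ::
  "nat \<Rightarrow> (real \<Rightarrow> real) \<Rightarrow> int \<Rightarrow> (real \<Rightarrow> real) \<Rightarrow> (real \<Rightarrow> real) \<Rightarrow> real \<Rightarrow> real \<times> real" where
  "linop n \<Phi> m u v r =
     (- deriv (deriv u) r - 1 / r * deriv u r + coeff_B \<Phi> r * deriv u r
        + (of_int m)\<^sup>2 / r\<^sup>2 * u r + (coeff_C n \<Phi> r + coeff_D n \<Phi> r) * u r
        + of_int m * coeff_A n \<Phi> r * v r,
      - deriv (deriv v) r - 1 / r * deriv v r + coeff_B \<Phi> r * deriv v r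
        + (of_int m)\<^sup>2 / r\<^sup>2 * v r + (coeff_C n \<Phi> r - coeff_D n \<Phi> r) * v r
        + of_int m * coeff_A n \<Phi> r * u r)"

definition Phi1 :: "real \<Rightarrow> real" where
  "Phi1 r = r / sqrt (r\<^sup>2 + 4)"

abbreviation linop1 ::
  "int \<Rightarrow> (real \<Rightarrow> real) \<Rightarrow> (real \<Rightarrow> real) \<Rightarrow> real \<Rightarrow> real \<times> real" where
  "linop1 \<equiv> linop 1 Phi1"

text \<open>
  \<open>deriv\<close> is total, so differentiability is required explicitly.  Since \<open>{0<..}\<close> is open,
  the conditions below say that the function is twice differentiable at every point of it;
  its values outside \<open>{0<..}\<close> are irrelevant.
\<close>

definition twice_differentiable_pos :: "(real \<Rightarrow> real) \<Rightarrow> bool" where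
  "twice_differentiable_pos f \<longleftrightarrow>
     f differentiable_on {0<..} \<and> deriv f differentiable_on {0<..}"

definition homogeneous_solution :: "int \<Rightarrow> (real \<Rightarrow> real) \<Rightarrow> (real \<Rightarrow> real) \<Rightarrow> bool" where
  "homogeneous_solution m u v \<longleftrightarrow>
     twice_differentiable_pos u \<and> twice_differentiable_pos v \<and>
     (\<forall>r>0. linop1 m u v r = (0, 0))"

end

theory Submission
  imports Defs
begin

text \<open>
  Let \<open>w = r (r\<^sup>2 + 4) / (r\<^sup>2 + 8)\<close>, which makes the system self-adjoint. For \<open>m \<noteq> 0\<close> take
  \<open>p = \<Phi>'\<close>, \<open>q = \<Phi> / r\<close>: both are positive, and \<open>(p, \<minusplus>q)\<close> is the translation mode of the vortex for
  \<open>m = \<plusminus>1\<close>. For \<open>m = 0\<close> the system decouples; take \<open>p = q = \<Phi>\<close>, the phase rotation mode of the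
  second equation and a strict supersolution of the first.
  With \<open>\<alpha> = p'/p\<close> and \<open>\<beta> = q'/q\<close>, the function \<open>E = w (u (u' - \<alpha> u) + v (v' - \<beta> v))\<close> satisfies
  the Picone identity
  \<open>E' = w ((u' - \<alpha> u)\<^sup>2 + (v' - \<beta> v)\<^sup>2 + N)\<close> for an explicit quadratic form \<open>N\<close> in \<open>(u, v)\<close>, which
  turns out to be nonnegative for every \<open>m\<close> and definite for \<open>\<bar>m\<bar> \<ge> 2\<close>.
  As \<open>u\<close>, \<open>v\<close> are bounded and \<open>w \<le> r\<close>, the Cauchy-Schwarz inequality gives \<open>E\<^sup>2 \<le> K r E'\<close>. Since
  \<open>\<integral> dr/r\<close> diverges at both ends of \<open>(0, \<infinity>)\<close>, this forces \<open>E = 0\<close>, so all three summands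
  vanish. No analysis of the asymptotics of solutions at \<open>0\<close> or \<open>\<infinity>\<close> is needed.
\<close>

section \<open>Liouville argument from a Picone identity\<close>

text \<open>Dividing by \<open>(E r)^2\<close> turns the growth bound into
  \<open>(- 1 / E)' \<ge> 1 / (K r)\<close>. As \<open>E\<close> is nondecreasing, a positive value
  persists to the right of \<open>a\<close> and a negative one to the left. Since \<open>ln\<close>
  is unbounded at both ends of the half-line, \<open>- 1 / E\<close> would change sign in either
  case.\<close>

lemma power2_le_derivative_imp_zero:
  fixes E E' :: "real \<Rightarrow> real"
  assumes deriv: "\<And>r. r > 0 \<Longrightarrow> (E has_real_derivative E' r) (at r)"
    and growth: "\<And>r. r > 0 \<Longrightarrow> (E r)\<^sup>2 \<le> K * r * E' r"
    and K: "K > 0" and a: "a > 0"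
  shows "E a = 0"
proof (rule ccontr)
  assume E_a: "E a \<noteq> 0"
  have nonneg: "E' r \<ge> 0" if "r > 0" for r
  proof -
    have "0 \<le> K * r * E' r"
      using growth[OF that] zero_le_power2[of "E r"] by linarith
    then show ?thesis
      using mult_pos_pos[OF K that] by (metis linorder_not_le zero_le_mult_iff)
  qed
  have mono: "E x \<le> E y" if "0 < x" "x \<le> y" for x y
  proof (rule DERIV_nonneg_imp_nondecreasing[OF \<open>x \<le> y\<close>])
    fix r assume "x \<le> r"
    then have "r > 0" using \<open>0 < x\<close> by linarith
    then show "\<exists>d. DERIV E r :> d \<and> d \<ge> 0" using deriv nonneg by blast
  qed
  \<comment> \<open>\<open>H\<close> is nonincreasing wherever \<open>E \<noteq> 0\<close>; at \<open>b\<close> below its logarithm has compensated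
    \<open>1 / E a\<close>, so \<open>E b\<close> would have the sign opposite to \<open>E a\<close>.\<close>
  define H where "H r = inverse (E r) + ln r / K" for r
  have H_mono: "H y \<le> H x"
    if "0 < x" "x \<le> y" and nz: "\<And>r. x \<le> r \<Longrightarrow> r \<le> y \<Longrightarrow> E r \<noteq> 0" for x y
  proof (rule DERIV_nonpos_imp_nonincreasing[OF \<open>x \<le> y\<close>])
    fix r assume r: "x \<le> r" "r \<le> y"
    then have "r > 0" "E r \<noteq> 0" using that by auto
    have "(H has_real_derivative - (inverse (E r) * E' r * inverse (E r)) + inverse r / K) (at r)"
      unfolding H_def
      by (intro DERIV_add DERIV_inverse' DERIV_cdivide DERIV_ln deriv \<open>r > 0\<close> \<open>E r \<noteq> 0\<close>)
    moreover have "- (inverse (E r) * E' r * inverse (E r)) + inverse r / K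
        = - E' r / (E r)\<^sup>2 + 1 / (K * r)"
      by (simp add: divide_inverse power2_eq_square mult_ac)
    moreover have "- E' r / (E r)\<^sup>2 + 1 / (K * r) \<le> 0"
      using growth[OF \<open>r > 0\<close>] \<open>r > 0\<close> \<open>E r \<noteq> 0\<close> K by (simp add: field_simps)
    ultimately show "\<exists>y. DERIV H r :> y \<and> y \<le> 0" by metis
  qed
  define b where "b = a * exp (K / E a)"
  have b: "b > 0" using a by (simp add: b_def)
  have H_b: "H b = inverse (E b) + ln a / K + inverse (E a)"
    using a K E_a by (simp add: H_def b_def ln_mult field_simps)
  show False
  proof (cases "E a > 0")
    case True
    then have "a \<le> b" using a K by (simp add: b_def)
    then have pos: "E r > 0" if "a \<le> r" for r
      using mono[OF a that] True by linarith
    have "H b \<le> H a"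
      using pos by (intro H_mono[OF a \<open>a \<le> b\<close>]) fastforce
    then have "inverse (E b) \<le> 0"
      by (simp add: H_b) (simp add: H_def)
    then show False
      using pos[OF \<open>a \<le> b\<close>] by simp
  next
    case False
    then have "E a < 0" using E_a by simp
    then have "K / E a < 0" using K by (simp add: divide_pos_neg)
    then have "b \<le> a" using a by (simp add: b_def)
    have neg: "E r < 0" if "0 < r" "r \<le> a" for r
      using mono[OF that] \<open>E a < 0\<close> by linarith
    have "E r \<noteq> 0" if "b \<le> r" "r \<le> a" for r
      using neg[of r] b that by auto
    then have "H a \<le> H b"
      by (rule H_mono[OF b \<open>b \<le> a\<close>])
    then have "0 \<le> inverse (E b)"
      by (simp add: H_b) (simp add: H_def)
    then show False
      using neg[OF b \<open>b \<le> a\<close>] by simp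
  qed
qed

text \<open>For \<open>\<alpha> = p' / p\<close> the hypothesis \<open>w\<alpha>\<close> is the
  Riccati form of \<open>(w p')' = w (P - g) p\<close>, so the reference functions \<open>p\<close>,
  \<open>q\<close> themselves never appear. Thus \<open>g\<close> and \<open>h\<close> are what the
  Picone identity leaves of the potentials, and the common coupling \<open>b\<close> contributes the
  cross term \<open>2 b u v\<close>.\<close>

lemma bounded_solution_liouville:
  fixes u u' v v' w \<alpha> \<beta> :: "real \<Rightarrow> real"
  assumes u: "\<And>r. r > 0 \<Longrightarrow> (u has_real_derivative u' r) (at r)"
    and v: "\<And>r. r > 0 \<Longrightarrow> (v has_real_derivative v' r) (at r)"
    and wu: "\<And>r. r > 0 \<Longrightarrow>
      ((\<lambda>r. w r * u' r) has_real_derivative w r * (P r * u r + b r * v r)) (at r)"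
    and wv: "\<And>r. r > 0 \<Longrightarrow>
      ((\<lambda>r. w r * v' r) has_real_derivative w r * (Q r * v r + b r * u r)) (at r)"
    and w\<alpha>: "\<And>r. r > 0 \<Longrightarrow>
      ((\<lambda>r. w r * \<alpha> r) has_real_derivative w r * (P r - g r - (\<alpha> r)\<^sup>2)) (at r)"
    and w\<beta>: "\<And>r. r > 0 \<Longrightarrow>
      ((\<lambda>r. w r * \<beta> r) has_real_derivative w r * (Q r - h r - (\<beta> r)\<^sup>2)) (at r)"
    and w: "\<And>r. r > 0 \<Longrightarrow> 0 < w r" "\<And>r. r > 0 \<Longrightarrow> w r \<le> r"
    and form: "\<And>r. r > 0 \<Longrightarrow>
      0 \<le> g r * (u r)\<^sup>2 + h r * (v r)\<^sup>2 + 2 * b r * (u r * v r)"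
    and bounded: "bounded (u ` {0<..})" "bounded (v ` {0<..})"
    and r: "r > 0"
  shows "u' r = \<alpha> r * u r" "v' r = \<beta> r * v r"
    "g r * (u r)\<^sup>2 + h r * (v r)\<^sup>2 + 2 * b r * (u r * v r) = 0"
proof -
  define X where "X r = u' r - \<alpha> r * u r" for r
  define Y where "Y r = v' r - \<beta> r * v r" for r
  define N where "N r = g r * (u r)\<^sup>2 + h r * (v r)\<^sup>2 + 2 * b r * (u r * v r)" for r
  define E where "E r = w r * (u r * X r + v r * Y r)" for r
  define E' where "E' r = w r * ((X r)\<^sup>2 + (Y r)\<^sup>2 + N r)" for r
  \<comment> \<open>The factor \<open>w\<close> stays attached to \<open>u'\<close>,
    \<open>v'\<close>, \<open>\<alpha>\<close> and \<open>\<beta>\<close> because the hypotheses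
    give derivatives of these products only.\<close>
  have E_eq: "E = (\<lambda>r. u r * (w r * u' r) - w r * \<alpha> r * (u r)\<^sup>2
                 + (v r * (w r * v' r) - w r * \<beta> r * (v r)\<^sup>2))"
    by (auto simp: fun_eq_iff E_def X_def Y_def algebra_simps power2_eq_square)
  have E: "(E has_real_derivative E' r) (at r)" if "r > 0" for r
    unfolding E_eq
    by (rule derivative_eq_intros refl u v wu wv w\<alpha> w\<beta> that)+
      (simp add: E'_def X_def Y_def N_def algebra_simps power2_eq_square)
  obtain K1 where K1: "\<And>r. r > 0 \<Longrightarrow> \<bar>u r\<bar> \<le> K1"
    using bounded(1) by (auto simp: bounded_iff)
  obtain K2 where K2: "\<And>r. r > 0 \<Longrightarrow> \<bar>v r\<bar> \<le> K2"
    using bounded(2) by (auto simp: bounded_iff)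
  \<comment> \<open>The summand 1 keeps \<open>K\<close> positive when both bounds are zero.\<close>
  define K where "K = K1\<^sup>2 + K2\<^sup>2 + 1"
  have "K > 0" by (simp add: K_def add_nonneg_pos)
  have growth: "(E r)\<^sup>2 \<le> K * r * E' r" if r: "r > 0" for r
  proof -
    \<comment> \<open>Cauchy-Schwarz in the plane: by Lagrange's identity the two sides differ by
      \<open>(u Y - v X)^2\<close>.\<close>
    have "(u r * X r + v r * Y r)\<^sup>2 \<le> ((u r)\<^sup>2 + (v r)\<^sup>2) * ((X r)\<^sup>2 + (Y r)\<^sup>2)"
      using zero_le_power2[of "u r * Y r - v r * X r"]
      by (simp add: power2_eq_square algebra_simps)
    also have "\<dots> \<le> K * ((X r)\<^sup>2 + (Y r)\<^sup>2 + N r)"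
    proof (rule mult_mono)
      have "(u r)\<^sup>2 \<le> K1\<^sup>2" "(v r)\<^sup>2 \<le> K2\<^sup>2"
        using K1[OF r] K2[OF r] by (simp_all add: abs_le_square_iff[symmetric])
      then show "(u r)\<^sup>2 + (v r)\<^sup>2 \<le> K" by (simp add: K_def)
    qed (use form[OF r] \<open>K > 0\<close> in \<open>auto simp: N_def\<close>)
    \<comment> \<open>Of the two factors \<open>w\<close> in \<open>E^2\<close>, one is bounded by
      \<open>r\<close> and the other is absorbed into \<open>E'\<close>.\<close>
    finally have "w r * (w r * (u r * X r + v r * Y r)\<^sup>2)
        \<le> r * (w r * (K * ((X r)\<^sup>2 + (Y r)\<^sup>2 + N r)))"
      using w[OF r] r by (intro mult_mono mult_nonneg_nonneg) auto
    then show ?thesis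
      by (simp add: E_def E'_def power_mult_distrib power2_eq_square mult_ac)
  qed
  have zero: "E x = 0" if "x > 0" for x
    using power2_le_derivative_imp_zero[OF E growth \<open>K > 0\<close> that] .
  have "((\<lambda>_. 0) has_real_derivative E' r) (at r)"
    by (rule has_field_derivative_transform_within_open[OF E[OF r], of "{0<..}"])
      (use r zero in auto)
  then have "E' r = 0"
    using DERIV_const DERIV_unique by blast
  then have "(X r)\<^sup>2 + (Y r)\<^sup>2 + N r = 0"
    using w(1)[OF r] by (simp add: E'_def)
  then have "(X r)\<^sup>2 = 0" "(Y r)\<^sup>2 = 0" "N r = 0"
    using form[OF r] unfolding N_def[symmetric] by (smt (verit) zero_le_power2)+
  then show "u' r = \<alpha> r * u r" "v' r = \<beta> r * v r"
    "g r * (u r)\<^sup>2 + h r * (v r)\<^sup>2 + 2 * b r * (u r * v r) = 0"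
    by (simp_all add: X_def Y_def N_def)
qed

section \<open>The coefficients at the explicit profile\<close>

lemma has_real_derivative_Phi1: "(Phi1 has_real_derivative 4 / sqrt (r\<^sup>2 + 4) ^ 3) (at r)"
proof -
  have pos: "r\<^sup>2 + 4 > 0" by (simp add: add_nonneg_pos)
  define t where "t = sqrt (r\<^sup>2 + 4)"
  have t: "t > 0" "t\<^sup>2 = r\<^sup>2 + 4" using pos by (auto simp: t_def)
  have "(Phi1 has_real_derivative (t - r * (r / t)) / t\<^sup>2) (at r)"
    unfolding Phi1_def t_def using pos
    by (auto intro!: derivative_eq_intros simp: power2_eq_square field_simps)
  also have "(t - r * (r / t)) / t\<^sup>2 = (t\<^sup>2 - r\<^sup>2) / t ^ 3"
    using t(1) by (simp add: field_simps power2_eq_square power3_eq_cube)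
  finally show ?thesis
    by (simp add: t t_def)
qed

lemma deriv_Phi1: "deriv Phi1 r = 4 / sqrt (r\<^sup>2 + 4) ^ 3"
  by (rule DERIV_imp_deriv[OF has_real_derivative_Phi1])

text \<open>The square root \<open>t = sqrt (s + 4)\<close> enters the coefficients only through
  even powers, so they are rational in \<open>s\<close>, up to one factor \<open>r\<close> in
  \<open>coeff_B\<close>. The squared factor \<open>s + 8\<close> in the denominators of single
  terms reduces to a simple one in \<open>C + D\<close> and \<open>C - D\<close>.\<close>

lemma
  fixes r :: real
  defines "s \<equiv> r\<^sup>2"
  assumes r: "r > 0"
  shows coeff_A_Phi1: "coeff_A 1 Phi1 r = 4 * (s + 4) / (s * (s + 8))"
    and coeff_B_Phi1: "coeff_B Phi1 r = - 8 * r / ((s + 4) * (s + 8))"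
    and coeff_C_plus_D_Phi1: "coeff_C 1 Phi1 r + coeff_D 1 Phi1 r
      = (s ^ 4 + 24 * s ^ 3 + 104 * s\<^sup>2 - 16 * s + 128) / (s * (s + 4)\<^sup>2 * (s + 8))"
    and coeff_C_minus_D_Phi1: "coeff_C 1 Phi1 r - coeff_D 1 Phi1 r
      = 8 * (16 - 2 * s - s\<^sup>2) / (s * (s + 4)\<^sup>2 * (s + 8))"
proof -
  have s: "s > 0" using r by (simp add: s_def)
  have Phi_sq: "(Phi1 r)\<^sup>2 = s / (s + 4)"
    using s by (simp add: Phi1_def power_divide s_def[symmetric])
  have Phi_4: "Phi1 r ^ 4 = (s / (s + 4))\<^sup>2"
    using Phi_sq by (metis power2_eq_square power4_eq_xxxx mult.assoc)
  define t where "t = sqrt (s + 4)"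
  have t: "t > 0" "t\<^sup>2 = s + 4" using s by (auto simp: t_def)
  have dPhi: "deriv Phi1 r = 4 / t ^ 3" and Phi: "Phi1 r = r / t"
    by (simp_all add: deriv_Phi1 Phi1_def t_def s_def)
  have "(t ^ 3)\<^sup>2 = (t\<^sup>2) ^ 3"
    by (simp flip: power_mult)
  then have dPhi_sq: "(deriv Phi1 r)\<^sup>2 = 16 / (s + 4) ^ 3"
    by (simp add: dPhi power_divide t)
  have "t * t ^ 3 = (t\<^sup>2)\<^sup>2"
    by (simp add: power2_eq_square power3_eq_cube mult_ac)
  then have Phi_dPhi: "Phi1 r * deriv Phi1 r = 4 * r / (s + 4)\<^sup>2"
    by (simp add: dPhi Phi t)
  have two_minus: "2 - s / (s + 4) = (s + 8) / (s + 4)"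
    using s by (simp add: field_simps)
  show "coeff_A 1 Phi1 r = 4 * (s + 4) / (s * (s + 8))"
    using s by (simp add: coeff_A_def Phi_sq two_minus s_def[symmetric])
  show "coeff_B Phi1 r = - 8 * r / ((s + 4) * (s + 8))"
    using s by (simp add: coeff_B_def Phi_sq two_minus mult.assoc Phi_dPhi)
      (simp add: divide_simps, simp add: algebra_simps power2_eq_square)
  have C: "coeff_C 1 Phi1 r = 4 * (s + 4)\<^sup>2 / (s * (s + 8)\<^sup>2)
      - 16 * s / ((s + 4)\<^sup>2 * (s + 8)\<^sup>2) - 3 / 2 * s\<^sup>2 / (s + 4)\<^sup>2 + 3 * s / (s + 4) - 1"
    using s unfolding coeff_C_def Phi_sq Phi_4 two_minus dPhi_sq s_def[symmetric]
    by (simp add: power_divide power2_eq_square[of "s + 4"] power3_eq_cube[of "s + 4"])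
  have D: "coeff_D 1 Phi1 r = 2 * (s + 4) / (s + 8)\<^sup>2
      - 32 / ((s + 4) * (s + 8)\<^sup>2) - s\<^sup>2 / (s + 4)\<^sup>2 + 3 / 2 * s / (s + 4)"
    using s unfolding coeff_D_def Phi_sq Phi_4 two_minus dPhi_sq s_def[symmetric]
    by (simp add: power_divide power2_eq_square[of "s + 4"] power3_eq_cube[of "s + 4"])
  show "coeff_C 1 Phi1 r + coeff_D 1 Phi1 r
      = (s ^ 4 + 24 * s ^ 3 + 104 * s\<^sup>2 - 16 * s + 128) / (s * (s + 4)\<^sup>2 * (s + 8))"
    using s unfolding C D
    apply (simp add: divide_simps)
    apply (simp add: algebra_simps power2_eq_square power3_eq_cube power4_eq_xxxx)
    done
  show "coeff_C 1 Phi1 r - coeff_D 1 Phi1 r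
      = 8 * (16 - 2 * s - s\<^sup>2) / (s * (s + 4)\<^sup>2 * (s + 8))"
    using s unfolding C D
    apply (simp add: divide_simps)
    apply (simp add: algebra_simps power2_eq_square power3_eq_cube power4_eq_xxxx)
    done
qed

section \<open>The weight and the Riccati equations of the reference modes\<close>

text \<open>For \<open>r > 0\<close> this is \<open>r / (2 - (Phi1 r)^2)\<close>.\<close>

definition weight :: "real \<Rightarrow> real" where
  "weight r = r * (r\<^sup>2 + 4) / (r\<^sup>2 + 8)"

lemma weight_pos: "r > 0 \<Longrightarrow> weight r > 0"
  by (simp add: weight_def add_nonneg_pos)

lemma weight_le: "r > 0 \<Longrightarrow> weight r \<le> r"
  by (simp add: weight_def divide_le_eq add_nonneg_pos)

text \<open>This is the integrating-factor equation: it gives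
  \<open>(w u')' = w (u'' + u' / r - B u')\<close>, which absorbs all first-order terms of the
  operator.\<close>

lemma DERIV_weight:
  assumes "r > 0"
  shows "(weight has_real_derivative weight r * (1 / r - coeff_B Phi1 r)) (at r)"
proof -
  have pos: "r\<^sup>2 + 4 > 0" "r\<^sup>2 + 8 > 0" by (simp_all add: add_nonneg_pos)
  have "(weight has_real_derivative
      ((3 * r\<^sup>2 + 4) * (r\<^sup>2 + 8) - 2 * r\<^sup>2 * (r\<^sup>2 + 4)) / (r\<^sup>2 + 8)\<^sup>2) (at r)"
    unfolding weight_def using pos
    by (auto intro!: derivative_eq_intros simp: power2_eq_square algebra_simps)
  also have "((3 * r\<^sup>2 + 4) * (r\<^sup>2 + 8) - 2 * r\<^sup>2 * (r\<^sup>2 + 4)) / (r\<^sup>2 + 8)\<^sup>2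
      = weight r * (1 / r - coeff_B Phi1 r)"
    unfolding coeff_B_Phi1[OF assms] weight_def using assms pos
    apply (simp add: divide_simps)
    apply (simp add: algebra_simps power2_eq_square)
    done
  finally show ?thesis .
qed

text \<open>Here \<open>- 3 r / (r^2 + 4)\<close> is the logarithmic derivative of
  \<open>p = \<Phi>'\<close>. The subtracted term is \<open>A q / p\<close> with
  \<open>q = \<Phi> / r\<close>, that is, the coupling of the first equation at the translation mode
  \<open>(p, - q)\<close> for \<open>m = 1\<close>, divided by \<open>p\<close>.\<close>

lemma riccati_translation_fst:
  fixes r :: real
  assumes "r > 0"
  shows "((\<lambda>r. weight r * (- 3 * r / (r\<^sup>2 + 4))) has_real_derivative
    weight r * (1 / r\<^sup>2 + (coeff_C 1 Phi1 r + coeff_D 1 Phi1 r)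
      - (r\<^sup>2 + 4)\<^sup>2 / (r\<^sup>2 * (r\<^sup>2 + 8)) - (- 3 * r / (r\<^sup>2 + 4))\<^sup>2)) (at r)"
proof -
  have pos: "x\<^sup>2 + 4 > 0" "x\<^sup>2 + 8 > 0" for x :: real by (simp_all add: add_nonneg_pos)
  have nz: "x\<^sup>2 + 4 \<noteq> 0" "x\<^sup>2 + 8 \<noteq> 0" for x :: real using pos[of x] by simp_all
  have eq: "weight x * (- 3 * x / (x\<^sup>2 + 4)) = - 3 * x\<^sup>2 / (x\<^sup>2 + 8)" for x
    using nz[of x] by (simp add: weight_def power2_eq_square)
  have "((\<lambda>x. - 3 * x\<^sup>2 / (x\<^sup>2 + 8)) has_real_derivative - 48 * r / (r\<^sup>2 + 8)\<^sup>2) (at r)"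
    using nz by (auto intro!: derivative_eq_intros simp: power2_eq_square algebra_simps)
  also have "- 48 * r / (r\<^sup>2 + 8)\<^sup>2 =
    weight r * (1 / r\<^sup>2 + (coeff_C 1 Phi1 r + coeff_D 1 Phi1 r)
      - (r\<^sup>2 + 4)\<^sup>2 / (r\<^sup>2 * (r\<^sup>2 + 8)) - (- 3 * r / (r\<^sup>2 + 4))\<^sup>2)"
    unfolding coeff_C_plus_D_Phi1[OF assms] weight_def using assms nz
    apply (simp add: divide_simps)
    apply (simp add: algebra_simps eval_nat_numeral)
    done
  finally show ?thesis unfolding eq .
qed

text \<open>The counterpart for \<open>q = \<Phi> / r\<close>, whose logarithmic derivative is
  \<open>- r / (r^2 + 4)\<close>; the subtracted term is \<open>A p / q\<close>.\<close>

lemma riccati_translation_snd: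
  fixes r :: real
  assumes "r > 0"
  shows "((\<lambda>r. weight r * (- r / (r\<^sup>2 + 4))) has_real_derivative
    weight r * (1 / r\<^sup>2 + (coeff_C 1 Phi1 r - coeff_D 1 Phi1 r)
      - 16 / (r\<^sup>2 * (r\<^sup>2 + 8)) - (- r / (r\<^sup>2 + 4))\<^sup>2)) (at r)"
proof -
  have pos: "x\<^sup>2 + 4 > 0" "x\<^sup>2 + 8 > 0" for x :: real by (simp_all add: add_nonneg_pos)
  have nz: "x\<^sup>2 + 4 \<noteq> 0" "x\<^sup>2 + 8 \<noteq> 0" for x :: real using pos[of x] by simp_all
  have eq: "weight x * (- x / (x\<^sup>2 + 4)) = - (x\<^sup>2 / (x\<^sup>2 + 8))" for x
    using nz[of x] by (simp add: weight_def power2_eq_square)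
  have "((\<lambda>x. - (x\<^sup>2 / (x\<^sup>2 + 8))) has_real_derivative - 16 * r / (r\<^sup>2 + 8)\<^sup>2) (at r)"
    using nz by (auto intro!: derivative_eq_intros simp: power2_eq_square algebra_simps)
  also have "- 16 * r / (r\<^sup>2 + 8)\<^sup>2 =
    weight r * (1 / r\<^sup>2 + (coeff_C 1 Phi1 r - coeff_D 1 Phi1 r)
      - 16 / (r\<^sup>2 * (r\<^sup>2 + 8)) - (- r / (r\<^sup>2 + 4))\<^sup>2)"
    unfolding coeff_C_minus_D_Phi1[OF assms] weight_def using assms nz
    apply (simp add: divide_simps)
    apply (simp add: algebra_simps eval_nat_numeral)
    done
  finally show ?thesis unfolding eq .
qed

text \<open>The phase rotation mode \<open>(0, Phi1)\<close> solves the decoupled second equation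
  for \<open>m = 0\<close>, so the potential \<open>C - D\<close> enters without correction;
  \<open>4 / (r (r^2 + 4))\<close> is the logarithmic derivative of \<open>Phi1\<close>.\<close>

lemma riccati_rotation:
  fixes r :: real
  assumes "r > 0"
  shows "((\<lambda>r. weight r * (4 / (r * (r\<^sup>2 + 4)))) has_real_derivative
    weight r * (coeff_C 1 Phi1 r - coeff_D 1 Phi1 r - (4 / (r * (r\<^sup>2 + 4)))\<^sup>2)) (at r)"
proof -
  have pos: "x\<^sup>2 + 4 > 0" "x\<^sup>2 + 8 > 0" for x :: real by (simp_all add: add_nonneg_pos)
  have nz: "x\<^sup>2 + 4 \<noteq> 0" "x\<^sup>2 + 8 \<noteq> 0" for x :: real using pos[of x] by simp_all
  \<comment> \<open>At \<open>x = 0\<close> the right side is 0 and the left side is 1/2, so the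
    derivative is transferred on the open half-line instead of by rewriting the function.\<close>
  have eq: "4 / (x\<^sup>2 + 8) = weight x * (4 / (x * (x\<^sup>2 + 4)))" if "x \<in> {0<..}" for x
    using nz[of x] that by (simp add: weight_def)
  have "((\<lambda>x. 4 / (x\<^sup>2 + 8)) has_real_derivative - 8 * r / (r\<^sup>2 + 8)\<^sup>2) (at r)"
    using nz by (auto intro!: derivative_eq_intros simp: power2_eq_square algebra_simps)
  also have "- 8 * r / (r\<^sup>2 + 8)\<^sup>2 =
    weight r * (coeff_C 1 Phi1 r - coeff_D 1 Phi1 r - (4 / (r * (r\<^sup>2 + 4)))\<^sup>2)"
    unfolding coeff_C_minus_D_Phi1[OF assms] weight_def using assms nz
    apply (simp add: divide_simps)
    apply (simp add: algebra_simps eval_nat_numeral)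
    done
  finally show ?thesis
    by (rule has_field_derivative_transform_within_open[of _ _ _ "{0<..}"])
      (use eq assms in auto)
qed

section \<open>Positivity, and recovery of a function from its logarithmic derivative\<close>

text \<open>In the difference of \<open>C + D\<close> and \<open>C - D\<close> the terms
  \<open>- 16 s + 128\<close> cancel, leaving a numerator with positive coefficients. This makes
  \<open>Phi1\<close> a strict supersolution of the first equation for \<open>m = 0\<close>.\<close>

lemma coeff_D_Phi1_pos:
  assumes "r > 0"
  shows "coeff_D 1 Phi1 r > 0"
proof -
  define s where "s = r\<^sup>2"
  have s: "s > 0" using assms by (simp add: s_def)
  have "2 * coeff_D 1 Phi1 r
      = (s ^ 4 + 24 * s ^ 3 + 104 * s\<^sup>2 - 16 * s + 128) / (s * (s + 4)\<^sup>2 * (s + 8))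
        - 8 * (16 - 2 * s - s\<^sup>2) / (s * (s + 4)\<^sup>2 * (s + 8))"
    using coeff_C_plus_D_Phi1[OF assms] coeff_C_minus_D_Phi1[OF assms] by (simp add: s_def)
  also have "\<dots> = (s ^ 4 + 24 * s ^ 3 + 112 * s\<^sup>2) / (s * (s + 4)\<^sup>2 * (s + 8))"
    by (simp add: diff_divide_distrib[symmetric])
  also have "\<dots> > 0"
    using s by (intro divide_pos_pos mult_pos_pos add_pos_pos) auto
  finally show ?thesis by simp
qed

lemma binary_form_pos:
  fixes g h b x y :: real
  assumes "g > 0" "b\<^sup>2 < g * h" "x \<noteq> 0 \<or> y \<noteq> 0"
  shows "g * x\<^sup>2 + h * y\<^sup>2 + 2 * b * (x * y) > 0"
proof -
  have "g * (g * x\<^sup>2 + h * y\<^sup>2 + 2 * b * (x * y)) = (g * x + b * y)\<^sup>2 + (g * h - b\<^sup>2) * y\<^sup>2"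
    by (simp add: algebra_simps power2_eq_square)
  also have "\<dots> > 0"
  proof (cases "y = 0")
    case True
    then show ?thesis using assms by simp
  next
    case False
    then show ?thesis using assms by (intro add_nonneg_pos) auto
  qed
  finally show ?thesis using assms(1) by (simp add: zero_less_mult_iff)
qed

text \<open>The quotient \<open>f / p\<close> has zero derivative. This integrates the first-order
  equations that the Liouville argument leaves.\<close>

lemma same_log_derivative_imp_proportional:
  fixes f p :: "real \<Rightarrow> real"
  assumes f: "\<And>r. r > 0 \<Longrightarrow> (f has_real_derivative \<alpha> r * f r) (at r)"
    and p: "\<And>r. r > 0 \<Longrightarrow> (p has_real_derivative \<alpha> r * p r) (at r)"
    and nz: "\<And>r. r > 0 \<Longrightarrow> p r \<noteq> 0"
  obtains c where "\<And>r. r > 0 \<Longrightarrow> f r = c * p r"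
proof -
  have "((\<lambda>r. f r / p r) has_real_derivative 0) (at r)" if "r > 0" for r
    using f[OF that] p[OF that] nz[OF that] by (auto intro!: derivative_eq_intros)
  then have "\<exists>c. \<forall>r\<in>{0<..}. f r / p r = c"
    by (intro has_field_derivative_zero_constant)
      (auto intro: has_field_derivative_at_within)
  then obtain c where "\<And>r. r > 0 \<Longrightarrow> f r / p r = c" by auto
  then show ?thesis
    using nz by (intro that[of c]) (metis nonzero_eq_divide_eq)
qed

lemma DERIV_Phi1:
  assumes "r > 0"
  shows "(Phi1 has_real_derivative 4 / (r * (r\<^sup>2 + 4)) * Phi1 r) (at r)"
proof -
  have "r\<^sup>2 + 4 > 0" by (simp add: add_nonneg_pos)
  then have "4 / sqrt (r\<^sup>2 + 4) ^ 3 = 4 / (r * (r\<^sup>2 + 4)) * Phi1 r"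
    using assms by (simp add: Phi1_def power3_eq_cube)
  then show ?thesis
    using has_real_derivative_Phi1[of r] by simp
qed

lemma DERIV_deriv_Phi1:
  "(deriv Phi1 has_real_derivative - 3 * r / (r\<^sup>2 + 4) * deriv Phi1 r) (at r)"
proof -
  define t where "t = sqrt (r\<^sup>2 + 4)"
  have pos: "r\<^sup>2 + 4 > 0" by (simp add: add_nonneg_pos)
  then have t: "t > 0" "r\<^sup>2 + 4 = t\<^sup>2" by (simp_all add: t_def)
  have "((\<lambda>r. sqrt (r\<^sup>2 + 4)) has_real_derivative r / t) (at r)"
    using pos by (auto intro!: derivative_eq_intros simp: t_def field_simps)
  note DERIV_power[OF this, of 3]
  then have "((\<lambda>r. 4 / sqrt (r\<^sup>2 + 4) ^ 3) has_real_derivative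
      - (4 * (3 * t\<^sup>2 * (r / t)) / (t ^ 3)\<^sup>2)) (at r)"
    by (rule DERIV_cong[OF DERIV_divide[OF DERIV_const]])
      (use t in \<open>simp_all add: t_def[symmetric] power2_eq_square\<close>)
  then have "(deriv Phi1 has_real_derivative - (4 * (3 * t\<^sup>2 * (r / t)) / (t ^ 3)\<^sup>2)) (at r)"
    by (simp add: deriv_Phi1[abs_def])
  also have "- (4 * (3 * t\<^sup>2 * (r / t)) / (t ^ 3)\<^sup>2) = - 3 * r / (r\<^sup>2 + 4) * deriv Phi1 r"
    unfolding deriv_Phi1 t_def[symmetric] unfolding t(2)
    using t(1) by (simp add: field_simps eval_nat_numeral)
  finally show ?thesis .
qed

text \<open>The ratio \<open>q / p\<close> of the two translation components, by which
  \<open>v\<close> is expressed through \<open>u\<close> when \<open>m\<close> is 1 or -1.\<close>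

lemma Phi1_div_eq:
  assumes "r > 0"
  shows "Phi1 r / r = (r\<^sup>2 + 4) / 4 * deriv Phi1 r"
proof -
  define t where "t = sqrt (r\<^sup>2 + 4)"
  have "r\<^sup>2 + 4 > 0" by (simp add: add_nonneg_pos)
  then have t: "t > 0" "r\<^sup>2 + 4 = t\<^sup>2" by (simp_all add: t_def)
  have "t\<^sup>2 / 4 * (4 / t ^ 3) = 1 / t"
    using t(1) by (simp add: power2_eq_square power3_eq_cube)
  then show ?thesis
    using assms t(1) by (simp add: deriv_Phi1 Phi1_def t(2) abs_of_pos)
qed

section \<open>Bounded solutions, mode by mode\<close>

context
  fixes m :: int and u v :: "real \<Rightarrow> real"
  assumes sol: "homogeneous_solution m u v"
begin

lemma DERIV_solution:
  assumes "r > 0"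
  shows "(u has_real_derivative deriv u r) (at r)" "(v has_real_derivative deriv v r) (at r)"
    "(deriv u has_real_derivative deriv (deriv u) r) (at r)"
    "(deriv v has_real_derivative deriv (deriv v) r) (at r)"
  using sol assms
  by (auto simp: homogeneous_solution_def twice_differentiable_pos_def
      DERIV_deriv_iff_real_differentiable differentiable_on_eq_differentiable_at)

lemma DERIV_weight_fst:
  assumes "r > 0"
  shows "((\<lambda>r. weight r * deriv u r) has_real_derivative
    weight r * ((of_int m ^ 2 / r\<^sup>2 + (coeff_C 1 Phi1 r + coeff_D 1 Phi1 r)) * u r
      + of_int m * coeff_A 1 Phi1 r * v r)) (at r)"
proof -
  have eq: "deriv (deriv u) r = - (1 / r * deriv u r) + coeff_B Phi1 r * deriv u r
      + ((of_int m)\<^sup>2 / r\<^sup>2 + (coeff_C 1 Phi1 r + coeff_D 1 Phi1 r)) * u r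
      + of_int m * coeff_A 1 Phi1 r * v r"
    using sol assms by (auto simp: homogeneous_solution_def linop_def algebra_simps)
  show ?thesis
    by (rule DERIV_cong[OF DERIV_mult[OF DERIV_weight[OF assms] DERIV_solution(3)[OF assms]]],
        simp only: eq)
      (simp add: algebra_simps)
qed

lemma DERIV_weight_snd:
  assumes "r > 0"
  shows "((\<lambda>r. weight r * deriv v r) has_real_derivative
    weight r * ((of_int m ^ 2 / r\<^sup>2 + (coeff_C 1 Phi1 r - coeff_D 1 Phi1 r)) * v r
      + of_int m * coeff_A 1 Phi1 r * u r)) (at r)"
proof -
  have eq: "deriv (deriv v) r = - (1 / r * deriv v r) + coeff_B Phi1 r * deriv v r
      + ((of_int m)\<^sup>2 / r\<^sup>2 + (coeff_C 1 Phi1 r - coeff_D 1 Phi1 r)) * v r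
      + of_int m * coeff_A 1 Phi1 r * u r"
    using sol assms by (auto simp: homogeneous_solution_def linop_def algebra_simps)
  show ?thesis
    by (rule DERIV_cong[OF DERIV_mult[OF DERIV_weight[OF assms] DERIV_solution(4)[OF assms]]],
        simp only: eq)
      (simp add: algebra_simps)
qed

lemma bounded_solution_mode_zero:
  assumes "m = 0" "bounded (u ` {0<..})" "bounded (v ` {0<..})"
  obtains c where "\<And>r. r > 0 \<Longrightarrow> u r = 0 \<and> v r = c * Phi1 r"
proof -
  define \<beta> where "\<beta> r = 4 / (r * (r\<^sup>2 + 4))" for r :: real
  \<comment> \<open>Subtracting \<open>g = 2 D\<close> turns the first potential
    \<open>C + D\<close> into the second one \<open>C - D\<close>, so the rotation identity serves
    both equations, with \<open>h = 0\<close>.\<close>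
  have riccati:
    "((\<lambda>r. weight r * \<beta> r) has_real_derivative weight r *
        ((of_int m)\<^sup>2 / r\<^sup>2 + (coeff_C 1 Phi1 r + coeff_D 1 Phi1 r)
         - 2 * coeff_D 1 Phi1 r - (\<beta> r)\<^sup>2)) (at r)"
    "((\<lambda>r. weight r * \<beta> r) has_real_derivative weight r *
        ((of_int m)\<^sup>2 / r\<^sup>2 + (coeff_C 1 Phi1 r - coeff_D 1 Phi1 r) - 0 - (\<beta> r)\<^sup>2)) (at r)"
    if "r > 0" for r
    using riccati_rotation[OF that] \<open>m = 0\<close> by (simp_all add: \<beta>_def)
  have form: "0 \<le> 2 * coeff_D 1 Phi1 r * (u r)\<^sup>2 + 0 * (v r)\<^sup>2
      + 2 * (of_int m * coeff_A 1 Phi1 r) * (u r * v r)" if "r > 0" for r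
    using coeff_D_Phi1_pos[OF that] \<open>m = 0\<close> by simp
  note liouville = bounded_solution_liouville[where g = "\<lambda>r. 2 * coeff_D 1 Phi1 r" and h = "\<lambda>_. 0"
      and b = "\<lambda>r. of_int m * coeff_A 1 Phi1 r" and \<alpha> = \<beta> and \<beta> = \<beta>,
      OF DERIV_solution(1,2) DERIV_weight_fst DERIV_weight_snd riccati weight_pos weight_le
      form assms(2,3)]
  have *: "deriv v r = \<beta> r * v r"
    "2 * coeff_D 1 Phi1 r * (u r)\<^sup>2 + 0 * (v r)\<^sup>2
      + 2 * (of_int m * coeff_A 1 Phi1 r) * (u r * v r) = 0" if r: "r > 0" for r
    by (rule liouville(2)[OF _ _ _ _ _ _ _ _ _ r]; assumption)
      (rule liouville(3)[OF _ _ _ _ _ _ _ _ _ r]; assumption)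
  have "(v has_real_derivative 4 / (r * (r\<^sup>2 + 4)) * v r) (at r)" if "r > 0" for r
    using DERIV_solution(2)[OF that] *(1)[OF that] by (simp add: \<beta>_def)
  then obtain c where "\<And>r. r > 0 \<Longrightarrow> v r = c * Phi1 r"
    by (rule same_log_derivative_imp_proportional[OF _ DERIV_Phi1])
      (auto simp: Phi1_def add_nonneg_eq_0_iff)
  moreover have "u r = 0" if "r > 0" for r
    using *(2)[OF that] coeff_D_Phi1_pos[OF that] \<open>m = 0\<close> by simp
  ultimately show ?thesis
    using that by blast
qed

text \<open>The Riccati identities carry the centrifugal term \<open>1 / r^2\<close> of
  \<open>m = 1\<close>, so a general \<open>m\<close> leaves the excess
  \<open>(m^2 - 1) / r^2\<close> in both \<open>g\<close> and \<open>h\<close>. Nonnegativity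
  remains a hypothesis because the form is degenerate for \<open>\<bar>m\<bar> = 1\<close> and
  definite for \<open>\<bar>m\<bar> \<ge> 2\<close>.\<close>

lemma bounded_solution_liouville_translation:
  fixes r :: real
  defines "g \<equiv> \<lambda>r. ((of_int m)\<^sup>2 - 1) / r\<^sup>2 + (r\<^sup>2 + 4)\<^sup>2 / (r\<^sup>2 * (r\<^sup>2 + 8))"
    and "h \<equiv> \<lambda>r. ((of_int m)\<^sup>2 - 1) / r\<^sup>2 + 16 / (r\<^sup>2 * (r\<^sup>2 + 8))"
    and "b \<equiv> \<lambda>r. of_int m * (4 * (r\<^sup>2 + 4) / (r\<^sup>2 * (r\<^sup>2 + 8)))"
  assumes bounded: "bounded (u ` {0<..})" "bounded (v ` {0<..})"
    and form: "\<And>r. r > 0 \<Longrightarrow> 0 \<le> g r * (u r)\<^sup>2 + h r * (v r)\<^sup>2 + 2 * b r * (u r * v r)"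
    and r: "r > 0"
  shows "deriv u r = - 3 * r / (r\<^sup>2 + 4) * u r"
    and "g r * (u r)\<^sup>2 + h r * (v r)\<^sup>2 + 2 * b r * (u r * v r) = 0"
proof -
  have b: "b r = of_int m * coeff_A 1 Phi1 r" if "r > 0" for r
    using coeff_A_Phi1[OF that] by (simp add: b_def)
  have wu: "((\<lambda>r. weight r * deriv u r) has_real_derivative weight r *
      (((of_int m)\<^sup>2 / r\<^sup>2 + (coeff_C 1 Phi1 r + coeff_D 1 Phi1 r)) * u r + b r * v r)) (at r)"
    if "r > 0" for r
    unfolding b[OF that] by (rule DERIV_weight_fst[OF that])
  have wv: "((\<lambda>r. weight r * deriv v r) has_real_derivative weight r *
      (((of_int m)\<^sup>2 / r\<^sup>2 + (coeff_C 1 Phi1 r - coeff_D 1 Phi1 r)) * v r + b r * u r)) (at r)"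
    if "r > 0" for r
    unfolding b[OF that] by (rule DERIV_weight_snd[OF that])
  have riccati_fst: "((\<lambda>r. weight r * (- 3 * r / (r\<^sup>2 + 4))) has_real_derivative weight r *
      ((of_int m)\<^sup>2 / r\<^sup>2 + (coeff_C 1 Phi1 r + coeff_D 1 Phi1 r) - g r
        - (- 3 * r / (r\<^sup>2 + 4))\<^sup>2)) (at r)" if "r > 0" for r
    using riccati_translation_fst[OF that] by (simp add: g_def diff_divide_distrib algebra_simps)
  have riccati_snd: "((\<lambda>r. weight r * (- r / (r\<^sup>2 + 4))) has_real_derivative weight r *
      ((of_int m)\<^sup>2 / r\<^sup>2 + (coeff_C 1 Phi1 r - coeff_D 1 Phi1 r) - h r
        - (- r / (r\<^sup>2 + 4))\<^sup>2)) (at r)" if "r > 0" for r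
    using riccati_translation_snd[OF that] by (simp add: h_def diff_divide_distrib algebra_simps)
  note liouville = bounded_solution_liouville[where g = g and h = h and b = b
      and \<alpha> = "\<lambda>r. - 3 * r / (r\<^sup>2 + 4)" and \<beta> = "\<lambda>r. - r / (r\<^sup>2 + 4)",
      OF DERIV_solution(1,2) wu wv riccati_fst riccati_snd weight_pos weight_le form bounded r]
  show "deriv u r = - 3 * r / (r\<^sup>2 + 4) * u r"
    by (rule liouville(1))
  show "g r * (u r)\<^sup>2 + h r * (v r)\<^sup>2 + 2 * b r * (u r * v r) = 0"
    by (rule liouville(3))
qed

text \<open>Here \<open>g = A q / p\<close> and \<open>h = A p / q\<close>, so
  \<open>g h = b^2\<close> and the form is a perfect square. Its vanishing determines
  \<open>v\<close> from \<open>u\<close>, while \<open>u' = \<alpha> u\<close> makes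
  \<open>u\<close> a multiple of \<open>deriv Phi1\<close>.\<close>

lemma bounded_solution_mode_one:
  assumes m: "\<bar>m\<bar> = 1" and bounded: "bounded (u ` {0<..})" "bounded (v ` {0<..})"
  obtains c where "\<And>r. r > 0 \<Longrightarrow> u r = c * deriv Phi1 r \<and> v r = - of_int m * c * (Phi1 r / r)"
proof -
  have m2: "(of_int m :: real)\<^sup>2 = 1"
    using m by (auto simp: abs_if split: if_splits)
  \<comment> \<open>Applied with \<open>k = r^2 + 4\<close> and \<open>p = r^2 (r^2 + 8)\<close>;
    \<open>m^2 = 1\<close> lets 16 be read as \<open>(4 m)^2\<close>.\<close>
  have square: "k\<^sup>2 / p * x\<^sup>2 + 16 / p * y\<^sup>2 + 2 * (of_int m * (4 * k / p)) * (x * y)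
      = (k * x + 4 * of_int m * y)\<^sup>2 / p" for k p x y :: real
    by (simp add: m2 power2_sum power_mult_distrib add_divide_distrib)
  have form: "(((of_int m)\<^sup>2 - 1) / r\<^sup>2 + (r\<^sup>2 + 4)\<^sup>2 / (r\<^sup>2 * (r\<^sup>2 + 8))) * (u r)\<^sup>2
      + (((of_int m)\<^sup>2 - 1) / r\<^sup>2 + 16 / (r\<^sup>2 * (r\<^sup>2 + 8))) * (v r)\<^sup>2
      + 2 * (of_int m * (4 * (r\<^sup>2 + 4) / (r\<^sup>2 * (r\<^sup>2 + 8)))) * (u r * v r)
    = ((r\<^sup>2 + 4) * u r + 4 * of_int m * v r)\<^sup>2 / (r\<^sup>2 * (r\<^sup>2 + 8))" for r
    unfolding square[symmetric] by (simp add: m2)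
  have *: "deriv u r = - 3 * r / (r\<^sup>2 + 4) * u r"
    "((r\<^sup>2 + 4) * u r + 4 * of_int m * v r)\<^sup>2 / (r\<^sup>2 * (r\<^sup>2 + 8)) = 0" if "r > 0" for r
    using bounded_solution_liouville_translation[OF bounded _ that] unfolding form by simp_all
  have "(u has_real_derivative - 3 * r / (r\<^sup>2 + 4) * u r) (at r)" if "r > 0" for r
    using DERIV_solution(1)[OF that] *(1)[OF that] by simp
  then obtain c where c: "\<And>r. r > 0 \<Longrightarrow> u r = c * deriv Phi1 r"
    by (rule same_log_derivative_imp_proportional[OF _ DERIV_deriv_Phi1])
      (auto simp: deriv_Phi1 add_nonneg_eq_0_iff)
  have "v r = - of_int m * c * (Phi1 r / r)" if "r > 0" for r
  proof -
    have "r\<^sup>2 + 8 > 0" by (simp add: add_nonneg_pos)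
    then have "(r\<^sup>2 + 4) * u r + 4 * of_int m * v r = 0"
      using *(2)[OF that] that by simp
    \<comment> \<open>Multiplying by \<open>m\<close> solves for \<open>v\<close> without division,
      since \<open>m^2 = 1\<close>.\<close>
    then have "of_int m * ((r\<^sup>2 + 4) * u r + 4 * of_int m * v r) = 0" by simp
    then have "4 * ((of_int m)\<^sup>2 * v r) = - of_int m * ((r\<^sup>2 + 4) * u r)"
      by (simp add: algebra_simps power2_eq_square)
    then show ?thesis
      by (simp add: m2 c[OF that] Phi1_div_eq[OF that] algebra_simps)
  qed
  then show ?thesis using that c by blast
qed

text \<open>The excess \<open>(m^2 - 1) / r^2\<close> makes the form positive definite, so its
  vanishing already forces \<open>u = v = 0\<close>.\<close>

lemma bounded_solution_higher_mode:
  assumes m: "\<bar>m\<bar> \<ge> 2" and bounded: "bounded (u ` {0<..})" "bounded (v ` {0<..})"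
    and r: "r > 0"
  shows "u r = 0 \<and> v r = 0"
proof -
  define g :: "real \<Rightarrow> real"
    where "g r = ((of_int m)\<^sup>2 - 1) / r\<^sup>2 + (r\<^sup>2 + 4)\<^sup>2 / (r\<^sup>2 * (r\<^sup>2 + 8))" for r
  define h :: "real \<Rightarrow> real"
    where "h r = ((of_int m)\<^sup>2 - 1) / r\<^sup>2 + 16 / (r\<^sup>2 * (r\<^sup>2 + 8))" for r
  define b :: "real \<Rightarrow> real"
    where "b r = of_int m * (4 * (r\<^sup>2 + 4) / (r\<^sup>2 * (r\<^sup>2 + 8)))" for r
  have "(2::real)\<^sup>2 \<le> \<bar>of_int m\<bar>\<^sup>2"
    using m by (intro power_mono) linarith+
  then have M: "(of_int m :: real)\<^sup>2 - 1 \<ge> 3" by simp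
  have form_pos: "0 < g r * (u r)\<^sup>2 + h r * (v r)\<^sup>2 + 2 * b r * (u r * v r)"
    if r: "r > 0" and nz: "u r \<noteq> 0 \<or> v r \<noteq> 0" for r
  proof (rule binary_form_pos[OF _ _ nz])
    define s where "s = r\<^sup>2"
    define M where "M = (of_int m :: real)\<^sup>2 - 1"
    have s: "s > 0" using r by (simp add: s_def)
    have M: "M \<ge> 3" using M by (simp add: M_def)
    show "g r > 0"
      using s M by (simp add: g_def s_def[symmetric] M_def[symmetric] add_pos_nonneg)
    have b2: "(b r)\<^sup>2 = (M + 1) * (4 * (s + 4) / (s * (s + 8)))\<^sup>2"
      by (simp only: b_def M_def s_def power_mult_distrib diff_add_cancel)
    \<comment> \<open>The factor \<open>M\<close> reflects the degeneracy at
      \<open>\<bar>m\<bar> = 1\<close>. The other factor is expanded around \<open>M = 3\<close>,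
      the value at \<open>\<bar>m\<bar> = 2\<close>, where the remaining polynomial in
      \<open>s\<close> has positive coefficients.\<close>
    have "g r * h r - (b r)\<^sup>2
        = M * ((M - 3) * (s + 8)\<^sup>2 + (s ^ 3 + 3 * s\<^sup>2 + 16 * s + 192)) / (s * (s + 8))\<^sup>2"
      unfolding b2 unfolding g_def h_def s_def[symmetric] M_def[symmetric] using s
      apply (simp add: divide_simps)
      apply (simp add: algebra_simps eval_nat_numeral)
      done
    also have "\<dots> > 0"
      using s M
      by (intro divide_pos_pos mult_pos_pos add_nonneg_pos mult_nonneg_nonneg add_pos_pos) auto
    finally show "(b r)\<^sup>2 < g r * h r" by simp
  qed
  have form: "0 \<le> g r * (u r)\<^sup>2 + h r * (v r)\<^sup>2 + 2 * b r * (u r * v r)" if "r > 0" for r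
    using form_pos[OF that] by (cases "u r = 0 \<and> v r = 0") auto
  have "g r * (u r)\<^sup>2 + h r * (v r)\<^sup>2 + 2 * b r * (u r * v r) = 0"
    using bounded_solution_liouville_translation(2)[OF bounded _ r]
      form[unfolded g_def h_def b_def] by (simp add: g_def h_def b_def)
  then show ?thesis
    using form_pos[OF r] by auto
qed

end

theorem lemma15:
  fixes m :: int and u v :: "real \<Rightarrow> real"
  assumes "homogeneous_solution m u v"
    and "bounded (u ` {0<..})" and "bounded (v ` {0<..})"
  shows "\<exists>a b c :: real. \<forall>r>0.
    (u r, v r) = a *\<^sub>R (0, Phi1 r)
               + b *\<^sub>R (deriv Phi1 r, - (1 / r * Phi1 r))
               + c *\<^sub>R (deriv Phi1 r, 1 / r * Phi1 r)"
proof -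
  consider "m = 0" | "\<bar>m\<bar> = 1" | "\<bar>m\<bar> \<ge> 2" by linarith
  then show ?thesis
  proof cases
    case 1
    then obtain c where "\<And>r. r > 0 \<Longrightarrow> u r = 0 \<and> v r = c * Phi1 r"
      using bounded_solution_mode_zero[OF assms(1) _ assms(2,3)] by blast
    then show ?thesis
      by (intro exI[of _ c] exI[of _ 0]) simp
  next
    case 2
    then obtain c where c: "\<And>r. r > 0 \<Longrightarrow> u r = c * deriv Phi1 r \<and> v r = - of_int m * c * (Phi1 r / r)"
      using bounded_solution_mode_one[OF assms(1) _ assms(2,3)] by blast
    \<comment> \<open>The sign of \<open>m\<close> selects the translation mode: the second spanning
      vector for \<open>m = 1\<close>, the third for \<open>m = - 1\<close>.\<close>
    from 2 consider "m = 1" | "m = - 1" by linarith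
    then show ?thesis
    proof cases
      case 1
      with c show ?thesis
        by (intro exI[of _ 0] exI[of _ c] exI[of _ 0]) simp
    next
      case 2
      with c show ?thesis
        by (intro exI[of _ 0] exI[of _ 0] exI[of _ c]) simp
    qed
  next
    case 3
    then show ?thesis
      using bounded_solution_higher_mode[OF assms(1) _ assms(2,3)]
      by (intro exI[of _ 0]) simp
  qed
qed

end
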